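(* Let $N\ge 1$ be an integer and let $\mathcal X$ be a finite alphabet with $|\mathcal X|\ge 2$. Let $M_4$ be the smallest positive integer $M$ such that every support-set $S\subseteq\mathcal X^N$ with cardinality $|S|>M$ requires each of the $N$ informants to transmit, i.e. satisfies $\#_n(S)=N$. Then $M_4=|\mathcal X|^{N-1}$.
   Context: A support-set is a nonempty subset $S\subseteq \mathcal X^N$ (the support of a joint probability distribution of $N$ random variables with values in $\mathcal X$). There are $N$ informants and a sink. A data-vector $x=(x_1,\dots,x_N)\in S$ is revealed to the informants, informant $i$ seeing only $x_i$; only the sink knows $S$. The sink must learn $x$ exactly by interactively querying informants: it queries one informant at a time, a queried informant $i$ reports its value $x_i$ to the sink, and the choice of the next informant to query (or the decision to stop) may depend on $S$ and on all the values reported so far. The sink stops when $x$ is the only element of $S$ consistent with the reported values (possibly without any query if $|S|=1$). Such a querying strategy is a deterministic adaptive protocol for $S$. For a protocol, its worst-case number of queried informants is the maximum, over $x\in S$, of the number of distinct informants queried when the data-vector is $x$. Define $\#_n(S)$ as the minimum over all protocols for $S$ of the worst-case number of queried informants; thus $0\le \#_n(S)\le N$. The support-set $S$ is said to require each of the $N$ informants to transmit (to be informant-incompressible) if $\#_n(S)=N$. *)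

theory Defs
  imports "HOL-Library.FuncSet"
begin

text \<open>Informants are numbered \<open>0, \<dots>, N - 1\<close>; a data-vector over the alphabet \<open>X\<close> is an element of
  \<open>{..<N} \<rightarrow>\<^sub>E X\<close>, the informant \<open>i\<close> holding the component \<open>x i\<close>.\<close>

definition support_set :: "nat \<Rightarrow> 'a set \<Rightarrow> (nat \<Rightarrow> 'a) set \<Rightarrow> bool" where
  "support_set N X S \<longleftrightarrow> S \<noteq> {} \<and> S \<subseteq> ({..<N} \<rightarrow>\<^sub>E X)"

text \<open>An adaptive querying strategy: \<open>Query i k\<close> asks informant \<open>i\<close> and continues with \<open>k v\<close> when
  the value \<open>v\<close> is reported. The support-set may enter the choice of the tree.\<close>

datatype 'a protocol = Stop | Query nat "'a \<Rightarrow> 'a protocol"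

primrec transcript :: "'a protocol \<Rightarrow> (nat \<Rightarrow> 'a) \<Rightarrow> (nat \<times> 'a) list" where
  "transcript Stop x = []"
| "transcript (Query i k) x = (i, x i) # transcript (k (x i)) x"

definition consistent :: "(nat \<Rightarrow> 'a) set \<Rightarrow> (nat \<times> 'a) list \<Rightarrow> (nat \<Rightarrow> 'a) set" where
  "consistent S t = {y \<in> S. \<forall>(i, v) \<in> set t. y i = v}"

definition queried :: "'a protocol \<Rightarrow> (nat \<Rightarrow> 'a) \<Rightarrow> nat set" where
  "queried P x = fst ` set (transcript P x)"

text \<open>On every data-vector of \<open>S\<close> the sink stops exactly at the first moment at which the reported
  values leave a single consistent element of \<open>S\<close>. An informant may be queried repeatedly; only
  distinct informants are counted below.\<close>

definition protocol_for :: "nat \<Rightarrow> (nat \<Rightarrow> 'a) set \<Rightarrow> 'a protocol \<Rightarrow> bool" where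
  "protocol_for N S P \<longleftrightarrow>
     (\<forall>x\<in>S. queried P x \<subseteq> {..<N} \<and>
        (\<forall>m \<le> length (transcript P x).
           consistent S (take m (transcript P x)) = {x} \<longleftrightarrow> m = length (transcript P x)))"

definition worst_case :: "(nat \<Rightarrow> 'a) set \<Rightarrow> 'a protocol \<Rightarrow> nat" where
  "worst_case S P = Max ((\<lambda>x. card (queried P x)) ` S)"

definition min_queried :: "nat \<Rightarrow> (nat \<Rightarrow> 'a) set \<Rightarrow> nat" where
  "min_queried N S = (LEAST q. \<exists>P. protocol_for N S P \<and> worst_case S P = q)"

definition informant_incompressible :: "nat \<Rightarrow> (nat \<Rightarrow> 'a) set \<Rightarrow> bool" where
  "informant_incompressible N S \<longleftrightarrow> min_queried N S = N"

definition M4 :: "nat \<Rightarrow> 'a set \<Rightarrow> nat" where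
  "M4 N X = (LEAST M. 0 < M \<and>
     (\<forall>S. support_set N X S \<and> card S > M \<longrightarrow> informant_incompressible N S))"

end

theory Submission
  imports Defs
begin

text \<open>A protocol determines the data-vector from its transcript, and a query tree whose paths each
  ask at most \<open>q\<close> distinct informants has at most \<open>card X ^ q\<close> different transcripts; so a
  support-set with more than \<open>card X ^ (N - 1)\<close> elements forces some path to ask everybody.
  Conversely, the support-set of all vectors with a fixed first component has exactly
  \<open>card X ^ (N - 1)\<close> elements, and informant \<open>0\<close> never needs to be asked.\<close>

section \<open>Counting transcripts of a query tree\<close>

lemma finite_queried: "finite (queried P x)"
  by (simp add: queried_def)

lemma queried_Stop [simp]: "queried Stop x = {}"
  by (simp add: queried_def)

lemma queried_Query [simp]: "queried (Query i k) x = insert i (queried (k (x i)) x)"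
  by (simp add: queried_def)

text \<open>\<open>D\<close> collects the informants whose values are already known: a repeated query does not branch.\<close>

lemma card_le_if_inj_on_transcript:
  assumes "finite X" "X \<noteq> {}" "finite S"
    and "\<And>x i. x \<in> S \<Longrightarrow> i \<in> queried P x \<Longrightarrow> x i \<in> X"
    and "inj_on (transcript P) S"
    and "\<And>x. x \<in> S \<Longrightarrow> card (queried P x - D) \<le> q"
    and "\<And>x y i. x \<in> S \<Longrightarrow> y \<in> S \<Longrightarrow> i \<in> D \<Longrightarrow> x i = y i"
  shows "card S \<le> card X ^ q"
  using assms(3-)
proof (induction P arbitrary: S D q)
  case Stop
  \<comment> \<open>The only transcript is empty, so injectivity leaves at most one vector.\<close>
  have "card S \<le> 1"
    using Stop.prems(1,3) by (auto simp: card_le_Suc0_iff_eq inj_on_def)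
  moreover have "1 \<le> card X ^ q"
    using assms(1,2) by (simp add: Suc_le_eq card_gt_0_iff)
  ultimately show ?case by linarith
next
  case (Query i k)
  define T where "T v = {x \<in> S. x i = v}" for v
  \<comment> \<open>Coordinate \<open>i\<close> is constant on \<open>T v\<close>, so the known set
    \<open>E\<close> passed to the subtree may include \<open>i\<close>. The choice
    \<open>E = D\<close> serves a repeated query, \<open>E = insert i D\<close> a new one.\<close>
  have bound: "card (T v) \<le> card X ^ r"
    if "\<And>x. x \<in> T v \<Longrightarrow> card (queried (k v) x - E) \<le> r" and "E \<subseteq> insert i D" for v r E
  proof (rule Query.IH)
    show "inj_on (transcript (k v)) (T v)"
      using Query.prems(3) by (auto simp: inj_on_def T_def)
  next
    fix x j
    assume "x \<in> T v" "j \<in> queried (k v) x"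
    then show "x j \<in> X"
      using Query.prems(2) by (auto simp: T_def)
  next
    fix x y j
    assume "x \<in> T v" "y \<in> T v" "j \<in> E"
    then show "x j = y j"
      using Query.prems(5)[of x y j] that(2) by (auto simp: T_def)
  qed (use Query.prems(1) that in \<open>auto simp: T_def\<close>)
  show ?case
  proof (cases "S = {}")
    case False
    then obtain z where z: "z \<in> S" by blast
    show ?thesis
    proof (cases "i \<in> D")
      case True
      \<comment> \<open>All of \<open>S\<close> reports the same value, so only one branch is alive
        and the budget \<open>q\<close> stays the same.\<close>
      have "S = T (z i)"
        using Query.prems(5)[OF _ z True] by (auto simp: T_def)
      moreover have "card (queried (k v) x - D) \<le> q" if "x \<in> T v" for x v
        using Query.prems(4)[of x] that True by (auto simp: T_def)
      ultimately show ?thesis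
        using bound[of "z i" D q] by auto
    next
      case False
      \<comment> \<open>A new informant is charged once, here. Putting it into the known set keeps
        later repetitions free, so every live branch has one unit less to spend.\<close>
      have step: "Suc (card (queried (k v) x - insert i D)) \<le> q" if "x \<in> T v" for x v
      proof -
        have "queried (Query i k) x - D = insert i (queried (k v) x - insert i D)"
          using that False by (auto simp: T_def)
        then have "card (queried (Query i k) x - D) = Suc (card (queried (k v) x - insert i D))"
          by (simp add: finite_queried)
        then show ?thesis
          using Query.prems(4)[of x] that by (auto simp: T_def)
      qed
      \<comment> \<open>The vector \<open>z\<close> pays for this query, hence \<open>q\<close> is
        positive; this is why empty \<open>S\<close> is split off.\<close>
      obtain r where r: "q = Suc r"
        using step[of z "z i"] z by (cases q) (auto simp: T_def)
      have "S \<subseteq> (\<Union>v\<in>X. T v)"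
        using Query.prems(2) by (auto simp: T_def)
      then have "card S \<le> card (\<Union>v\<in>X. T v)"
        using Query.prems(1) assms(1) by (intro card_mono) (auto simp: T_def)
      also have "\<dots> \<le> (\<Sum>v\<in>X. card (T v))"
        by (rule card_UN_le[OF assms(1)])
      also have "\<dots> \<le> (\<Sum>v\<in>X. card X ^ r)"
        using step r by (intro sum_mono bound[where E = "insert i D"]) auto
      finally show ?thesis by (simp add: r)
    qed
  qed simp
qed

text \<open>At full length the stopping condition says that the transcript is consistent with its
  own vector alone.\<close>

lemma protocol_for_inj_on_transcript:
  assumes "protocol_for N S P"
  shows "inj_on (transcript P) S"
proof (rule inj_onI)
  fix x y
  assume "x \<in> S" "y \<in> S" "transcript P x = transcript P y"
  moreover have "consistent S (transcript P z) = {z}" if "z \<in> S" for z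
    using assms that unfolding protocol_for_def by (metis order_refl take_all)
  ultimately show "x = y" by (metis singleton_inject)
qed

lemma finite_support_set:
  assumes "finite X" "support_set N X S"
  shows "finite S"
  using assms unfolding support_set_def by (meson finite_PiE finite_lessThan finite_subset)

lemma card_queried_le_worst_case:
  assumes "finite S" "x \<in> S"
  shows "card (queried P x) \<le> worst_case S P"
  using assms unfolding worst_case_def by (intro Max_ge) auto

lemma worst_case_le:
  assumes "finite S" "S \<noteq> {}" "\<And>x. x \<in> S \<Longrightarrow> card (queried P x) \<le> q"
  shows "worst_case S P \<le> q"
  using assms by (simp add: worst_case_def)

lemma worst_case_le_informants:
  assumes "finite S" "S \<noteq> {}" "protocol_for N S P"
  shows "worst_case S P \<le> N"
proof (rule worst_case_le[OF assms(1,2)])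
  fix x
  assume "x \<in> S"
  then have "queried P x \<subseteq> {..<N}"
    using assms(3) by (simp add: protocol_for_def)
  then show "card (queried P x) \<le> N"
    using card_mono[of "{..<N}"] by fastforce
qed

lemma card_support_set_le:
  assumes "finite X" "support_set N X S" "protocol_for N S P"
  shows "card S \<le> card X ^ worst_case S P"
proof (cases "N = 0")
  case True
  \<comment> \<open>Here \<open>X\<close> may be empty. The sole vector is the everywhere undefined
    function, and no informant can be queried, so the bound reads 1 \<le> 1.\<close>
  then have "S = {\<lambda>_. undefined}"
    using assms(2) by (auto simp: support_set_def)
  then show ?thesis
    using assms(3) True by (simp add: worst_case_def protocol_for_def)
next
  case False
  note fin = finite_support_set[OF assms(1,2)]
  have S: "S \<noteq> {}" "S \<subseteq> {..<N} \<rightarrow>\<^sub>E X"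
    using assms(2) by (auto simp: support_set_def)
  show ?thesis
  proof (rule card_le_if_inj_on_transcript[where D = "{}" and P = P])
    show "X \<noteq> {}"
      using S False by (auto simp: PiE_def Pi_def)
  next
    fix x i
    assume "x \<in> S" "i \<in> queried P x"
    then show "x i \<in> X"
      using S(2) assms(3) by (auto simp: protocol_for_def)
  qed (use assms(1) fin protocol_for_inj_on_transcript[OF assms(3)] in
        \<open>auto simp: card_queried_le_worst_case\<close>)
qed

section \<open>Protocols that ask in a fixed order\<close>

text \<open>The set argument is what remains consistent with the answers so far. The singleton test
  is there because a protocol must stop at the first moment of certainty, not merely by the end of
  the list.\<close>

primrec sequential :: "nat list \<Rightarrow> (nat \<Rightarrow> 'a) set \<Rightarrow> 'a protocol" where
  "sequential [] S = Stop"
| "sequential (i # is) S =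
     (if is_singleton S then Stop else Query i (\<lambda>v. sequential is {y \<in> S. y i = v}))"

lemma queried_sequential: "queried (sequential is S) x \<subseteq> set is"
  by (induction "is" arbitrary: S) (simp_all add: subset_insertI2 insert_mono)

lemma consistent_Nil [simp]: "consistent S [] = S"
  by (simp add: consistent_def)

lemma consistent_Cons: "consistent S ((i, v) # t) = consistent {y \<in> S. y i = v} t"
  by (auto simp: consistent_def)

text \<open>The first assumption says that the listed coordinates separate \<open>S\<close>. An
  answer from \<open>i\<close> makes that coordinate constant, so the rest of the list separates the
  surviving vectors and the induction continues.\<close>

lemma consistent_sequential_iff:
  assumes "\<And>x y. x \<in> S \<Longrightarrow> y \<in> S \<Longrightarrow> (\<And>i. i \<in> set is \<Longrightarrow> x i = y i) \<Longrightarrow> x = y"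
    and "x \<in> S" and "m \<le> length (transcript (sequential is S) x)"
  shows "consistent S (take m (transcript (sequential is S) x)) = {x}
    \<longleftrightarrow> m = length (transcript (sequential is S) x)"
  using assms
proof (induction "is" arbitrary: S m)
  case Nil
  then have "S = {x}" by auto
  then show ?case using Nil by simp
next
  case (Cons i "is")
  show ?case
  proof (cases "is_singleton S")
    case True
    then have "S = {x}" using Cons.prems(2) by (auto simp: is_singleton_def)
    then show ?thesis using Cons.prems(3) by (simp add: is_singleton_def)
  next
    case False
    let ?T = "{y \<in> S. y i = x i}"
    show ?thesis
    proof (cases m)
      case 0
      then show ?thesis using False by (auto simp: is_singleton_def)
    next
      case (Suc l)
      have "consistent ?T (take l (transcript (sequential is ?T) x)) = {x}
          \<longleftrightarrow> l = length (transcript (sequential is ?T) x)"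
      proof (rule Cons.IH)
        fix y z
        assume "y \<in> ?T" "z \<in> ?T" "\<And>j. j \<in> set is \<Longrightarrow> y j = z j"
        then show "y = z"
          by (intro Cons.prems(1)) auto
      qed (use Cons.prems(2,3) Suc False in auto)
      then show ?thesis
        using Suc False by (simp add: consistent_Cons)
    qed
  qed
qed

lemma protocol_for_sequential:
  assumes "set is \<subseteq> {..<N}"
    and "\<And>x y. x \<in> S \<Longrightarrow> y \<in> S \<Longrightarrow> (\<And>i. i \<in> set is \<Longrightarrow> x i = y i) \<Longrightarrow> x = y"
  shows "protocol_for N S (sequential is S)"
  unfolding protocol_for_def
  using assms(1) queried_sequential consistent_sequential_iff[OF assms(2)] by blast

text \<open>Guarantees that the \<open>LEAST\<close> in \<open>min_queried\<close> ranges over a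
  nonempty set of values.\<close>

lemma protocol_for_exists:
  assumes "support_set N X S"
  shows "\<exists>P. protocol_for N S P"
proof
  show "protocol_for N S (sequential [0..<N] S)"
  proof (rule protocol_for_sequential)
    fix x y
    assume "x \<in> S" "y \<in> S" and eq: "\<And>i. i \<in> set [0..<N] \<Longrightarrow> x i = y i"
    then have "x \<in> {..<N} \<rightarrow>\<^sub>E X" "y \<in> {..<N} \<rightarrow>\<^sub>E X"
      using assms by (auto simp: support_set_def)
    then show "x = y"
      by (rule PiE_ext) (simp add: eq)
  qed auto
qed

section \<open>The threshold and its sharpness\<close>

lemma informant_incompressible_if_card_gt:
  assumes "finite X" "X \<noteq> {}" "support_set N X S" "card X ^ (N - 1) < card S"
  shows "informant_incompressible N S"
proof -
  have fin: "finite S" and ne: "S \<noteq> {}"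
    using finite_support_set assms(1,3) by (auto simp: support_set_def)
  \<comment> \<open>All protocols share the worst case \<open>N\<close>, so the minimum is taken
    over a single value.\<close>
  have wc: "worst_case S P = N" if P: "protocol_for N S P" for P
  proof (rule antisym)
    show "worst_case S P \<le> N"
      by (rule worst_case_le_informants[OF fin ne P])
    show "N \<le> worst_case S P"
    proof (rule ccontr)
      assume "\<not> N \<le> worst_case S P"
      then have "card X ^ worst_case S P \<le> card X ^ (N - 1)"
        using assms(1,2) by (intro power_increasing) (auto simp: Suc_le_eq card_gt_0_iff)
      then show False
        using card_support_set_le[OF assms(1,3) P] assms(4) by linarith
    qed
  qed
  obtain P where "protocol_for N S P"
    using protocol_for_exists[OF assms(3)] by blast
  with wc show ?thesis
    unfolding informant_incompressible_def min_queried_def by (intro Least_equality) auto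
qed

lemma compressible_support_set_exists:
  assumes "1 \<le> N" "finite X" "X \<noteq> {}"
  shows "\<exists>S. support_set N X S \<and> card S = card X ^ (N - 1) \<and> \<not> informant_incompressible N S"
proof -
  obtain c where c: "c \<in> X" using assms(3) by blast
  define S where "S = PiE {..<N} (\<lambda>i. if i = 0 then {c} else X)"
  have sub: "S \<subseteq> {..<N} \<rightarrow>\<^sub>E X"
    unfolding S_def using c by (intro PiE_mono) auto
  have ne: "S \<noteq> {}"
    using c by (auto simp: S_def PiE_eq_empty_iff)
  have supp: "support_set N X S"
    using sub ne by (simp add: support_set_def)
  \<comment> \<open>Splits the product into a factor 1 for informant \<open>0\<close> and
    \<open>N - 1\<close> factors \<open>card X\<close>.\<close>
  have N: "{..<N} = insert 0 {1..<N}"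
    using assms(1) by auto
  have card: "card S = card X ^ (N - 1)"
    unfolding S_def by (subst card_PiE) (simp_all add: N)
  \<comment> \<open>Informant \<open>0\<close> is left out: its value is \<open>c\<close> throughout
    \<open>S\<close>, so the other coordinates already separate \<open>S\<close>.\<close>
  define P where "P = sequential [1..<N] S"
  have P: "protocol_for N S P"
    unfolding P_def
  proof (rule protocol_for_sequential)
    fix x y
    assume xy: "x \<in> S" "y \<in> S" and eq: "\<And>i. i \<in> set [1..<N] \<Longrightarrow> x i = y i"
    have "x 0 = y 0"
      using xy[unfolded S_def, THEN PiE_mem, of 0] assms(1) by simp
    with eq have "x i = y i" if "i \<in> {..<N}" for i
      using that by (cases "i = 0") auto
    then show "x = y"
      using xy unfolding S_def by (intro PiE_ext) auto
  qed auto
  have "card (queried P x) \<le> N - 1" for x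
    using card_mono[OF _ queried_sequential[of "[1..<N]" S x]] by (simp add: P_def)
  then have "worst_case S P \<le> N - 1"
    using finite_support_set[OF assms(2) supp] ne by (intro worst_case_le)
  moreover have "min_queried N S \<le> worst_case S P"
    unfolding min_queried_def using P by (intro Least_le) blast
  ultimately have "\<not> informant_incompressible N S"
    using assms(1) by (simp add: informant_incompressible_def)
  with supp card show ?thesis by blast
qed

theorem lemma4:
  fixes N :: nat and X :: "'a set"
  assumes "1 \<le> N" and "finite X" and "2 \<le> card X"
  shows "M4 N X = card X ^ (N - 1)"
proof -
  have ne: "X \<noteq> {}" using assms(3) by auto
  show ?thesis
    unfolding M4_def
  proof (rule Least_equality)
    show "0 < card X ^ (N - 1) \<and>
        (\<forall>S. support_set N X S \<and> card X ^ (N - 1) < card S \<longrightarrow> informant_incompressible N S)"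
      using assms(3) informant_incompressible_if_card_gt[OF assms(2) ne] by auto
  next
    fix M
    assume M: "0 < M \<and> (\<forall>S. support_set N X S \<and> M < card S \<longrightarrow> informant_incompressible N S)"
    obtain S where "support_set N X S" "card S = card X ^ (N - 1)" "\<not> informant_incompressible N S"
      using compressible_support_set_exists[OF assms(1,2) ne] by blast
    \<comment> \<open>If \<open>M\<close> were smaller, the compressible set \<open>S\<close> would
      have more than \<open>M\<close> elements.\<close>
    with M show "card X ^ (N - 1) \<le> M"
      by (metis not_le)
  qed
qed

end
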